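(* Let $d\in\mathbb{N}$ and let $\omega:[0,2)\to[0,\infty)$ be a concave, strictly increasing function with $\omega(0)=0$. Then there exists a Lipschitz bijection $f:\mathbb{Z}^d\to\mathbb{Z}^d$ which is $\omega$-co-homogeneous, but which is not $\widetilde{\omega}$-co-homogeneous for any concave, increasing function $\widetilde{\omega}:[0,2)\to[0,\infty)$ satisfying $\widetilde{\omega}(0)=0$ and $\lim_{t\to0^+}\frac{\widetilde{\omega}(t)}{\omega(t)}=0$.
   Context: $\mathbb{N}=\{1,2,\dots\}$, $\|\cdot\|$ is the Euclidean norm, $B(0,R)$ is the open ball of radius $R$ centred at $0$. For a non-decreasing function $\omega:[0,2)\to[0,\infty)$ with $\omega(0)=0$, a bijection $f:\mathbb{Z}^d\to\mathbb{Z}^d$ is $\omega$-co-homogeneous if there is $c>0$ such that for each $R>0$, $\|f^{-1}(x)-f^{-1}(y)\|\le cR\,\omega\left(\frac{\|x-y\|}{R}\right)$ whenever $x,y\in B(0,R)\cap\mathbb{Z}^d$. *)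

theory Defs
  imports "HOL-Analysis.Analysis"
begin

definition int_lattice :: "(real ^ 'n) set" where
  "int_lattice = {x. \<forall>i. x $ i \<in> \<int>}"

text \<open>
  Meant for \<open>f\<close> bijective from the lattice onto itself, so that \<open>inv_into int_lattice f\<close> is its
  inverse. Values of \<open>f\<close> off the lattice and of \<open>\<omega>\<close> outside \<open>[0, 2)\<close> play no role, since
  \<open>norm (x - y) / R < 2\<close> for \<open>x\<close> and \<open>y\<close> in \<open>ball 0 R\<close>.
\<close>

definition cohomogeneous :: "(real \<Rightarrow> real) \<Rightarrow> (real ^ 'n \<Rightarrow> real ^ 'n) \<Rightarrow> bool" where
  "cohomogeneous \<omega> f \<longleftrightarrow>
    (\<exists>c>0. \<forall>R>0. \<forall>x \<in> ball 0 R \<inter> int_lattice. \<forall>y \<in> ball 0 R \<inter> int_lattice.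
       norm (inv_into int_lattice f x - inv_into int_lattice f y) \<le> c * R * \<omega> (norm (x - y) / R))"

end

theory Submission
  imports Defs
begin

text \<open>
  Fold the first coordinate. The interval \<open>{0..<3 * m}\<close> has a permutation that is \<open>3\<close>-Lipschitz,
  fixes both end points, and traverses the interval upwards, downwards and upwards again, along the
  three residue classes modulo \<open>3\<close>; its inverse moves the neighbours \<open>0\<close> and \<open>1\<close> to distance
  \<open>2 * m - 1\<close>. Place such a fold, with \<open>m\<close> about \<open>4 ^ k * \<omega> (1 / 4 ^ k) / \<omega> 1\<close>, at the left end of
  each \<open>{4 ^ k..<4 ^ Suc k}\<close>. As \<open>R * \<omega> (1 / R)\<close> is monotone in \<open>R\<close>, the inverse displaces points
  of \<open>ball 0 R\<close> by at most a multiple of \<open>R * \<omega> (1 / R)\<close>, while the neighbours at the left end of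
  the \<open>k\<close>-th fold show that this is optimal at the scales \<open>R = 3 * 4 ^ k\<close>.
\<close>

section \<open>Folding an interval of integers\<close>

definition zigzag :: "int \<Rightarrow> int \<Rightarrow> int" where
  "zigzag m i =
    (if i < 0 \<or> 3 * m \<le> i then i
     else if i < m then 3 * i
     else if i < 2 * m then 3 * (2 * m - 1 - i) + 1
     else 3 * (i - 2 * m) + 2)"

definition unzigzag :: "int \<Rightarrow> int \<Rightarrow> int" where
  "unzigzag m j =
    (if j < 0 \<or> 3 * m \<le> j then j
     else if j mod 3 = 0 then j div 3
     else if j mod 3 = 1 then 2 * m - 1 - j div 3
     else 2 * m + j div 3)"

lemma unzigzag_zigzag: "unzigzag m (zigzag m i) = i"
proof -
  have "(3 * q + 1) div 3 = q" "(3 * q + 1) mod 3 = 1" "(3 * q + 2) div 3 = q" "(3 * q + 2) mod 3 = 2"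
    for q :: int
    by presburger+
  note this [simp]
  consider "i < 0 \<or> 3 * m \<le> i" | "0 \<le> i" "i < m" | "m \<le> i" "i < 2 * m" "0 \<le> m"
    | "2 * m \<le> i" "i < 3 * m" "0 \<le> m"
    by linarith
  then show ?thesis
  proof cases
    case 3
    define q where "q = 2 * m - 1 - i"
    have "zigzag m i = 3 * q + 1" using 3 by (auto simp: zigzag_def q_def)
    moreover have "0 \<le> q" "q < m" "i = 2 * m - 1 - q" using 3 by (auto simp: q_def)
    ultimately show ?thesis by (simp add: unzigzag_def)
  next
    case 4
    define q where "q = i - 2 * m"
    have "zigzag m i = 3 * q + 2" using 4 by (auto simp: zigzag_def q_def)
    moreover have "0 \<le> q" "q < m" "i = 2 * m + q" using 4 by (auto simp: q_def)
    ultimately show ?thesis by (simp add: unzigzag_def)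
  qed (auto simp: zigzag_def unzigzag_def)
qed

lemma zigzag_unzigzag: "zigzag m (unzigzag m j) = j"
proof (cases "j < 0 \<or> 3 * m \<le> j")
  case True
  then show ?thesis by (simp add: zigzag_def unzigzag_def)
next
  case False
  define q where "q = j div 3"
  have "j = 3 * q + j mod 3" "j mod 3 \<in> {0, 1, 2}"
    unfolding q_def by (simp_all, presburger)
  with False show ?thesis
    unfolding unzigzag_def q_def[symmetric] by (auto simp: zigzag_def)
qed

lemma zigzag_outside: "i < 0 \<or> 3 * m \<le> i \<Longrightarrow> zigzag m i = i"
  by (simp add: zigzag_def)

lemma unzigzag_outside: "i < 0 \<or> 3 * m \<le> i \<Longrightarrow> unzigzag m i = i"
  by (simp add: unzigzag_def)

lemma zigzag_inside: "0 \<le> i \<Longrightarrow> i < 3 * m \<Longrightarrow> 0 \<le> zigzag m i \<and> zigzag m i < 3 * m"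
  unfolding zigzag_def by auto

lemma unzigzag_inside: "0 \<le> i \<Longrightarrow> i < 3 * m \<Longrightarrow> 0 \<le> unzigzag m i \<and> unzigzag m i < 3 * m"
  unfolding unzigzag_def by auto

lemma zigzag_0: "zigzag m 0 = 0"
  by (auto simp: zigzag_def)

text \<open>The third pass ends on the fixed point \<open>3 * m - 1\<close>, so even a fold that
  fills its whole block joins the next block with a unit step.\<close>

lemma zigzag_last: "1 \<le> m \<Longrightarrow> 3 * m - 1 \<le> i \<Longrightarrow> zigzag m i = i"
  by (auto simp: zigzag_def)

text \<open>Within a pass the step is 3 or -3. For positive \<open>m\<close> the passes meet in unit
  steps, from \<open>3 * m - 3\<close> to \<open>3 * m - 2\<close> and from 1 to 2, and both ends
  join the identity in unit steps.\<close>

lemma zigzag_step: "\<bar>zigzag m (i + 1) - zigzag m i\<bar> \<le> 3"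
  unfolding zigzag_def by auto

section \<open>One fold in each block\<close>

text \<open>Block 0 takes in all integers below 4. For those below 1 the offset
  \<open>n - 4 ^ block n\<close> is negative, where \<open>zigzag\<close> and
  \<open>unzigzag\<close> are the identity.\<close>

definition block :: "int \<Rightarrow> nat" where
  "block n = (LEAST k. n < 4 ^ Suc k)"

text \<open>The parameter \<open>z\<close> lets one construction serve for the folds and for their
  inverses.\<close>

definition blockwise :: "(int \<Rightarrow> int \<Rightarrow> int) \<Rightarrow> (nat \<Rightarrow> int) \<Rightarrow> int \<Rightarrow> int" where
  "blockwise z m n = 4 ^ block n + z (m (block n)) (n - 4 ^ block n)"

lemma block_upper: "n < 4 ^ Suc (block n)"
proof -
  have "n < 2 ^ nat n \<or> n < 0"
    using of_nat_less_two_power[of "nat n", where 'a = int] by auto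
  moreover have "(2::int) ^ nat n \<le> 4 ^ nat n"
    by (intro power_mono) auto
  moreover have "(4::int) ^ nat n \<le> 4 ^ Suc (nat n)"
    by simp
  ultimately have "n < 4 ^ Suc (nat n)"
    by (smt (verit) zero_less_power)
  then show ?thesis
    unfolding block_def by (rule LeastI)
qed

lemma block_lower:
  assumes "block n \<noteq> 0"
  shows "4 ^ block n \<le> n"
proof -
  obtain k where k: "block n = Suc k"
    using assms not0_implies_Suc by blast
  then have "k < (LEAST k. n < 4 ^ Suc k)"
    by (simp add: block_def)
  from not_less_Least[OF this] show ?thesis
    by (simp add: k)
qed

lemma block_eqI:
  assumes "4 ^ k \<le> n \<or> k = 0" and "n < 4 ^ Suc k"
  shows "block n = k"
  unfolding block_def
proof (rule Least_equality)
  fix l assume l: "n < 4 ^ Suc l"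
  show "k \<le> l"
  proof (rule ccontr)
    assume "\<not> k \<le> l"
    then have "Suc l \<le> k" "k \<noteq> 0" by auto
    then have "(4::int) ^ Suc l \<le> 4 ^ k"
      by (intro power_increasing) auto
    with l assms(1) \<open>k \<noteq> 0\<close> show False by simp
  qed
qed (rule assms(2))

text \<open>A fold of length \<open>3 * m k\<close> fits into the \<open>3 * 4 ^ k\<close> integers
  from \<open>4 ^ k\<close> to the end of its block. Blocks are thus preserved, and inverting
  \<open>blockwise\<close> reduces to inverting \<open>z\<close>.\<close>

lemma block_displaced:
  assumes m: "m k \<le> (4::int) ^ k" and k: "k = block n"
    and out: "\<And>i. i < 0 \<or> 3 * m k \<le> i \<Longrightarrow> z (m k) i = i"
    and ins: "\<And>i. 0 \<le> i \<Longrightarrow> i < 3 * m k \<Longrightarrow> 0 \<le> z (m k) i \<and> z (m k) i < 3 * m k"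
  shows "block (blockwise z m n) = k"
proof (cases "n - 4 ^ k < 0 \<or> 3 * m k \<le> n - 4 ^ k")
  case True
  from out[OF this] show ?thesis
    by (simp add: blockwise_def k)
next
  case False
  with ins[of "n - 4 ^ k"] have "4 ^ k \<le> blockwise z m n \<and> blockwise z m n < 4 ^ k + 3 * m k"
    by (simp add: blockwise_def k[symmetric])
  with m show ?thesis
    by (intro block_eqI) auto
qed

context
  fixes m :: "nat \<Rightarrow> int"
  assumes m_ge: "\<And>k. 1 \<le> m k" and m_le: "\<And>k. m k \<le> 4 ^ k"
begin

lemma blockwise_unzigzag_zigzag: "blockwise unzigzag m (blockwise zigzag m n) = n"
proof -
  have "block (blockwise zigzag m n) = block n"
    by (rule block_displaced) (auto simp: m_le zigzag_outside zigzag_inside)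
  then show ?thesis
    by (simp add: blockwise_def[of unzigzag]) (simp add: blockwise_def unzigzag_zigzag)
qed

lemma blockwise_zigzag_unzigzag: "blockwise zigzag m (blockwise unzigzag m n) = n"
proof -
  have "block (blockwise unzigzag m n) = block n"
    by (rule block_displaced) (auto simp: m_le unzigzag_outside unzigzag_inside)
  then show ?thesis
    by (simp add: blockwise_def[of zigzag]) (simp add: blockwise_def zigzag_unzigzag)
qed

lemma blockwise_zigzag_step: "\<bar>blockwise zigzag m (n + 1) - blockwise zigzag m n\<bar> \<le> 3"
proof (cases "n + 1 < 4 ^ Suc (block n)")
  case True
  then have "block (n + 1) = block n"
    using block_lower[of n] by (intro block_eqI) auto
  with zigzag_step[of "m (block n)" "n - 4 ^ block n"] show ?thesis
    by (simp add: blockwise_def algebra_simps)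
next
  case False
  \<comment> \<open>At a block boundary both neighbours are fixed: \<open>n + 1\<close> is the left
    end of the next block, and \<open>n\<close> has offset \<open>3 * 4 ^ k - 1\<close>, at least
    \<open>3 * m k - 1\<close>, with \<open>k = block n\<close>.\<close>
  with block_upper[of n] have n: "n + 1 = 4 ^ Suc (block n)"
    by simp
  then have "block (n + 1) = Suc (block n)"
    by (intro block_eqI) auto
  with n have "blockwise zigzag m (n + 1) = n + 1"
    by (simp add: blockwise_def zigzag_0)
  moreover have "blockwise zigzag m n = n"
    using n m_le[of "block n"] zigzag_last[OF m_ge, of "block n" "n - 4 ^ block n"]
    by (simp add: blockwise_def)
  ultimately show ?thesis
    by simp
qed

lemma blockwise_zigzag_Lipschitz:
  "\<bar>blockwise zigzag m a - blockwise zigzag m b\<bar> \<le> 3 * \<bar>a - b\<bar>"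
proof -
  have *: "\<bar>blockwise zigzag m (a + int j) - blockwise zigzag m a\<bar> \<le> 3 * int j" for a j
  proof (induction j)
    case (Suc j)
    then show ?case
      using blockwise_zigzag_step[of "a + int j"] by (simp add: algebra_simps)
  qed simp
  show ?thesis
    using *[of a "nat (b - a)"] *[of b "nat (a - b)"] by (cases "a \<le> b") auto
qed

text \<open>A point inside a fold stays in it, so the length of the fold bounds the displacement.
  The bound \<open>4 ^ k \<le> n\<close> later ties \<open>k\<close> to the radius of a ball
  containing the point.\<close>

lemma blockwise_unzigzag_displacement:
  obtains "blockwise unzigzag m n = n"
  | k where "4 ^ k \<le> n" "\<bar>blockwise unzigzag m n - n\<bar> \<le> 3 * m k"
proof (cases "n - 4 ^ block n < 0 \<or> 3 * m (block n) \<le> n - 4 ^ block n")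
  case True
  with that(1) show ?thesis
    by (simp add: blockwise_def unzigzag_outside)
next
  case False
  with unzigzag_inside[of "n - 4 ^ block n" "m (block n)"]
  have "\<bar>blockwise unzigzag m n - n\<bar> \<le> 3 * m (block n)"
    unfolding blockwise_def by linarith
  with False show ?thesis
    by (intro that(2)) auto
qed

text \<open>Offset 1 has residue 1 and quotient 0 modulo 3: it is the value at the last point,
  \<open>2 * m k - 1\<close>, of the descending pass.\<close>

lemma blockwise_unzigzag_start:
  "blockwise unzigzag m (4 ^ k) = 4 ^ k"
  "blockwise unzigzag m (4 ^ k + 1) = 4 ^ k + 2 * m k - 1"
proof -
  have "(1::int) \<le> 4 ^ k"
    by simp
  then have "(4::int) ^ k + 1 < 4 ^ Suc k"
    unfolding power_Suc by linarith
  then have "block (4 ^ k) = k" "block (4 ^ k + 1) = k"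
    by (intro block_eqI; simp)+
  then show "blockwise unzigzag m (4 ^ k) = 4 ^ k"
    "blockwise unzigzag m (4 ^ k + 1) = 4 ^ k + 2 * m k - 1"
    using m_ge[of k] by (auto simp: blockwise_def unzigzag_def)
qed

end

section \<open>Acting on one coordinate\<close>

definition on_coord :: "'n \<Rightarrow> (int \<Rightarrow> int) \<Rightarrow> real ^ 'n \<Rightarrow> real ^ 'n" where
  "on_coord a h x = (\<chi> i. if i = a then of_int (h \<lfloor>x $ i\<rfloor>) else x $ i)"

lemma on_coord_in_lattice: "x \<in> int_lattice \<Longrightarrow> on_coord a h x \<in> int_lattice"
  by (auto simp: int_lattice_def on_coord_def)

lemma int_lattice_floor: "x \<in> int_lattice \<Longrightarrow> of_int \<lfloor>x $ i\<rfloor> = x $ i"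
  by (auto simp: int_lattice_def)

lemma on_coord_inverse:
  assumes "\<And>n. g (h n) = n" and "x \<in> int_lattice"
  shows "on_coord a g (on_coord a h x) = x"
  using assms by (simp add: vec_eq_iff on_coord_def int_lattice_floor)

lemma bij_betw_on_coord:
  assumes "\<And>n. g (h n) = n" and "\<And>n. h (g n) = n"
  shows "bij_betw (on_coord a h) int_lattice int_lattice"
  by (rule bij_betw_byWitness[where f' = "on_coord a g"])
    (auto simp: on_coord_in_lattice on_coord_inverse assms)

lemma inv_into_on_coord:
  assumes "\<And>n. g (h n) = n" and "\<And>n. h (g n) = n" and "x \<in> int_lattice"
  shows "inv_into int_lattice (on_coord a h) x = on_coord a g x"
  using bij_betw_on_coord[OF assms(1,2)] assms
  by (intro inv_into_f_eq) (auto simp: on_coord_in_lattice on_coord_inverse bij_betw_def)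

text \<open>The estimate is made componentwise, so the constant does not depend on the dimension;
  \<open>1 \<le> L\<close> covers the coordinates left unchanged.\<close>

lemma lipschitz_on_coord:
  assumes L: "1 \<le> L" and h: "\<And>a b. \<bar>h a - h b\<bar> \<le> L * \<bar>a - b\<bar>"
  shows "(of_int L)-lipschitz_on int_lattice (on_coord a h)"
proof (rule lipschitz_onI)
  fix x y :: "real ^ 'a"
  assume xy: "x \<in> int_lattice" "y \<in> int_lattice"
  have "norm (on_coord a h x - on_coord a h y) \<le> norm (of_int L *\<^sub>R (x - y))"
  proof (rule norm_le_componentwise_cart)
    fix i
    have "real_of_int \<bar>h \<lfloor>x $ i\<rfloor> - h \<lfloor>y $ i\<rfloor>\<bar> \<le> of_int (L * \<bar>\<lfloor>x $ i\<rfloor> - \<lfloor>y $ i\<rfloor>\<bar>)"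
      using h by (intro of_int_le_iff[THEN iffD2])
    moreover have "1 * \<bar>x $ i - y $ i\<bar> \<le> of_int L * \<bar>x $ i - y $ i\<bar>"
      using L by (intro mult_right_mono) auto
    ultimately show "norm ((on_coord a h x - on_coord a h y) $ i) \<le> norm ((of_int L *\<^sub>R (x - y)) $ i)"
      using xy L by (cases "i = a") (simp_all add: on_coord_def int_lattice_floor abs_mult)
  qed
  then show "dist (on_coord a h x) (on_coord a h y) \<le> of_int L * dist x y"
    using L by (simp add: dist_norm)
qed (use L in simp)

lemma norm_axis: "norm (axis a r :: real ^ 'n) = \<bar>r\<bar>"
  by (simp add: norm_eq_sqrt_inner inner_axis_axis)

lemma norm_on_coord_diff:
  assumes "x \<in> int_lattice"
  shows "norm (on_coord a h x - x) = of_int \<bar>h \<lfloor>x $ a\<rfloor> - \<lfloor>x $ a\<rfloor>\<bar>"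
proof -
  have "on_coord a h x - x = axis a (of_int (h \<lfloor>x $ a\<rfloor> - \<lfloor>x $ a\<rfloor>))"
    using assms by (auto simp: vec_eq_iff on_coord_def axis_def int_lattice_floor)
  then show ?thesis
    by (simp add: norm_axis)
qed

lemma on_coord_axis:
  "on_coord a h (axis a (of_int n)) = axis a (of_int (h n))"
  by (auto simp: vec_eq_iff on_coord_def axis_def)

lemma axis_in_lattice: "axis a (of_int n) \<in> int_lattice"
  by (auto simp: int_lattice_def axis_def)

text \<open>Allows a displacement bound in \<open>\<omega> (1 / R)\<close> to be absorbed into
  \<open>\<omega> (norm (x - y) / R)\<close> for distinct lattice points.\<close>

lemma norm_int_lattice_ge_1:
  assumes "x \<in> int_lattice" and "y \<in> int_lattice" and "x \<noteq> y"
  shows "1 \<le> norm (x - y)"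
proof -
  obtain i where i: "x $ i \<noteq> y $ i"
    using assms(3) by (auto simp: vec_eq_iff)
  have "x $ i - y $ i \<in> \<int>"
    using assms by (auto simp: int_lattice_def)
  with i have "1 \<le> \<bar>x $ i - y $ i\<bar>"
    using Ints_nonzero_abs_ge1[of "x $ i - y $ i"] by simp
  also have "\<dots> \<le> norm (x - y)"
    using component_le_norm_cart[of "x - y" i] by simp
  finally show ?thesis .
qed

section \<open>Concave moduli\<close>

text \<open>The point \<open>s\<close> is the convex combination of 0 and \<open>t\<close> with
  weight \<open>s / t\<close> on \<open>t\<close>; so the slope of the chord from 0 does not
  increase.\<close>

lemma concave_on_zero_slope:
  fixes \<omega> :: "real \<Rightarrow> real"
  assumes "concave_on {0..<b} \<omega>" and "\<omega> 0 = 0" and "0 < s" "s \<le> t" "t < b"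
  shows "s * \<omega> t \<le> t * \<omega> s"
proof -
  have "(1 - s / t) * \<omega> 0 + (s / t) * \<omega> t \<le> \<omega> ((1 - s / t) *\<^sub>R 0 + (s / t) *\<^sub>R t)"
    using assms by (intro concave_onD) auto
  then show ?thesis
    using assms by (simp add: field_simps)
qed

theorem lemma5p8:
  fixes \<omega> :: "real \<Rightarrow> real"
  assumes "\<omega> \<in> {0..<2} \<rightarrow> {0..}"
    and "concave_on {0..<2} \<omega>"
    and "strict_mono_on {0..<2} \<omega>"
    and "\<omega> 0 = 0"
  shows "\<exists>f :: real ^ 'n \<Rightarrow> real ^ 'n.
    bij_betw f int_lattice int_lattice \<and>
    (\<exists>L. L-lipschitz_on int_lattice f) \<and>
    cohomogeneous \<omega> f \<and>
    (\<forall>\<omega>' :: real \<Rightarrow> real.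
       \<omega>' \<in> {0..<2} \<rightarrow> {0..} \<and> concave_on {0..<2} \<omega>' \<and> mono_on {0..<2} \<omega>' \<and> \<omega>' 0 = 0 \<and>
       ((\<lambda>t. \<omega>' t / \<omega> t) \<longlongrightarrow> 0) (at_right 0)
       \<longrightarrow> \<not> cohomogeneous \<omega>' f)"
proof -
  have mono: "\<omega> s \<le> \<omega> t" if "0 \<le> s" "s \<le> t" "t < 2" for s t
    using strict_mono_on_leD[OF assms(3)] that by auto
  have pos: "0 < \<omega> t" if "0 < t" "t < 2" for t
    using strict_mono_onD[OF assms(3), of 0 t] that assms(4) by auto
  have slope: "s * \<omega> t \<le> t * \<omega> s" if "0 < s" "s \<le> t" "t < 2" for s t
    using concave_on_zero_slope[OF assms(2,4)] that by blast
  note \<omega>1 = pos[of 1, simplified]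

  \<comment> \<open>Dividing by \<open>\<omega> 1\<close> gives \<open>\<phi> 1 = 1\<close>. The
    slope inequality then yields \<open>1 \<le> \<phi> (4 ^ k)\<close>, and monotonicity of
    \<open>\<omega>\<close> yields \<open>\<phi> (4 ^ k) \<le> 4 ^ k\<close>, so the floor is an
    admissible fold size.\<close>
  define \<phi> where "\<phi> R = R * \<omega> (1 / R) / \<omega> 1" for R :: real
  have \<phi>_mono: "\<phi> r \<le> \<phi> R" if "1 \<le> r" "r \<le> R" for r R
  proof -
    have "r * \<omega> (1 / r) \<le> R * \<omega> (1 / R)"
      using slope[of "1 / R" "1 / r"] that by (simp add: field_simps)
    then show ?thesis
      using \<omega>1 by (simp add: \<phi>_def divide_right_mono)
  qed
  define m where "m k = \<lfloor>\<phi> (4 ^ k)\<rfloor>" for k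
  have \<phi>_ge: "1 \<le> \<phi> (4 ^ k)" for k
    using \<phi>_mono[of 1 "4 ^ k"] \<omega>1 by (simp add: \<phi>_def)
  have m_ge: "1 \<le> m k" for k
    using \<phi>_ge by (simp add: m_def)
  have m_le_\<phi>: "of_int (m k) \<le> \<phi> (4 ^ k)" for k
    by (simp add: m_def)
  have m_le: "m k \<le> 4 ^ k" for k
  proof -
    have "\<phi> (4 ^ k) \<le> 4 ^ k"
      using mono[of "1 / 4 ^ k" 1] \<omega>1 by (simp add: \<phi>_def pos_divide_le_eq)
    then have "real_of_int (m k) \<le> real_of_int (4 ^ k)"
      using m_le_\<phi>[of k] unfolding of_int_power of_int_numeral by (rule order_trans[rotated])
    then show ?thesis
      by (simp only: of_int_le_iff)
  qed

  define h g where "h = blockwise zigzag m" and "g = blockwise unzigzag m"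
  have gh: "\<And>n. g (h n) = n" and hg: "\<And>n. h (g n) = n"
    using blockwise_unzigzag_zigzag[OF m_ge m_le] blockwise_zigzag_unzigzag[OF m_ge m_le]
    by (simp_all add: g_def h_def)
  define a :: 'n where "a = undefined"
  define f where "f = on_coord a h"
  have inv: "inv_into int_lattice f x = on_coord a g x" if "x \<in> int_lattice" for x
    unfolding f_def using inv_into_on_coord[OF gh hg that] .

  \<comment> \<open>A moved point forces \<open>4 ^ k \<le> R\<close>, hence
    \<open>1 \<le> R\<close>, and \<open>\<phi>_mono\<close> applies. A fixed point may lie in a
    smaller ball; there \<open>0 \<le> \<phi> R\<close> suffices.\<close>
  have displacement: "norm (on_coord a g x - x) \<le> 3 * \<phi> R"
    if "x \<in> int_lattice" "norm x < R" "0 \<le> \<phi> R" for x R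
  proof (rule blockwise_unzigzag_displacement[OF m_ge m_le, where n = "\<lfloor>x $ a\<rfloor>"])
    assume "blockwise unzigzag m \<lfloor>x $ a\<rfloor> = \<lfloor>x $ a\<rfloor>"
    then show ?thesis
      using that by (simp add: norm_on_coord_diff g_def)
  next
    fix k assume k: "4 ^ k \<le> \<lfloor>x $ a\<rfloor>"
      and le: "\<bar>blockwise unzigzag m \<lfloor>x $ a\<rfloor> - \<lfloor>x $ a\<rfloor>\<bar> \<le> 3 * m k"
    have "real_of_int (4 ^ k) \<le> of_int \<lfloor>x $ a\<rfloor>"
      using k by (simp only: of_int_le_iff)
    then have "4 ^ k \<le> R"
      using component_le_norm_cart[of x a] that by (simp add: int_lattice_floor)
    then have "\<phi> (4 ^ k) \<le> \<phi> R"
      by (intro \<phi>_mono) auto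
    moreover have "norm (on_coord a g x - x) \<le> of_int (3 * m k)"
      unfolding norm_on_coord_diff[OF that(1)] g_def using le by (simp only: of_int_le_iff)
    ultimately show ?thesis
      using m_le_\<phi>[of k] by simp
  qed

  \<comment> \<open>Co-homogeneity with respect to \<omega>\<close>
  have "cohomogeneous \<omega> f"
    unfolding cohomogeneous_def
  proof (intro exI conjI allI impI ballI)
    \<comment> \<open>The constant is 3 + 3 + 2: two displacements of at most
      \<open>3 * \<phi> R\<close>, and the distance \<open>s\<close> itself, at most
      \<open>2 * (R * \<omega> (s / R) / \<omega> 1)\<close>.\<close>
    show "0 < 8 / \<omega> 1"
      using \<omega>1 by simp
    fix R :: real and x y :: "real ^ 'n"
    assume R: "0 < R" and x: "x \<in> ball 0 R \<inter> int_lattice" and y: "y \<in> ball 0 R \<inter> int_lattice"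
    define s where "s = norm (x - y)"
    have "norm (inv_into int_lattice f x - inv_into int_lattice f y)
        = norm (on_coord a g x - on_coord a g y)"
      using x y by (simp add: inv)
    also have "\<dots> \<le> 8 / \<omega> 1 * R * \<omega> (s / R)"
    proof (cases "x = y")
      case True
      then show ?thesis
        using assms(4) by (simp add: s_def)
    next
      case False
      then have s: "1 \<le> s"
        using x y norm_int_lattice_ge_1 by (auto simp: s_def)
      have "s < 2 * R"
        using norm_triangle_ineq4[of x y] x y by (simp add: s_def)
      then have sR: "s / R < 2"
        using R by (simp add: field_simps)
      have le1: "\<omega> (1 / R) \<le> \<omega> (s / R)"
        using s sR R by (intro mono) (auto simp: divide_right_mono)
      \<comment> \<open>Two distinct lattice points in the ball give
        \<open>1 \<le> s < 2 * R\<close>, so \<open>1 / R\<close> lies in the domain of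
        \<open>\<omega>\<close> even when \<open>R < 1\<close>.\<close>
      have "1 / R < 2"
        using s sR R by (smt (verit) divide_right_mono)
      then have "0 \<le> \<phi> R"
        using pos[of "1 / R"] R \<omega>1 by (simp add: \<phi>_def)
      then have "norm (on_coord a g x - x) \<le> 3 * \<phi> R" "norm (on_coord a g y - y) \<le> 3 * \<phi> R"
        using x y by (auto intro: displacement)
      moreover have "\<phi> R \<le> R * \<omega> (s / R) / \<omega> 1"
        using le1 R \<omega>1 by (simp add: \<phi>_def divide_right_mono)
      \<comment> \<open>Up to ratio 1 this is concavity; beyond 1, \<open>\<omega> (s / R)\<close>
        is at least \<open>\<omega> 1\<close> and the factor 2 comes from
        \<open>s / R < 2\<close>.\<close>
      moreover have "s \<le> 2 * (R * \<omega> (s / R) / \<omega> 1)"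
      proof (cases "s / R \<le> 1")
        case True
        then have "s / R * \<omega> 1 \<le> \<omega> (s / R)"
          using slope[of "s / R" 1] s R by simp
        moreover have "0 \<le> \<omega> (s / R)"
          using pos[of "s / R"] s R sR by simp
        ultimately have "s / R * \<omega> 1 \<le> 2 * \<omega> (s / R)"
          by simp
        then show ?thesis
          using R \<omega>1 by (simp add: field_simps)
      next
        case False
        then have "\<omega> 1 \<le> \<omega> (s / R)"
          using sR by (intro mono) auto
        then have "s / R * \<omega> 1 \<le> 2 * \<omega> (s / R)"
          using \<omega>1 sR False by (intro mult_mono) auto
        then show ?thesis
          using R \<omega>1 by (simp add: field_simps)
      qed
      moreover have "norm (on_coord a g x - on_coord a g y)
          \<le> s + norm (on_coord a g x - x) + norm (on_coord a g y - y)"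
        unfolding s_def by norm
      ultimately show ?thesis
        by simp
    qed
    finally show "norm (inv_into int_lattice f x - inv_into int_lattice f y)
        \<le> 8 / \<omega> 1 * R * \<omega> (norm (x - y) / R)"
      by (simp add: s_def)
  qed

  \<comment> \<open>Failure for moduli of smaller order at 0\<close>
  moreover have "\<not> cohomogeneous \<omega>' f"
    if lim: "((\<lambda>t. \<omega>' t / \<omega> t) \<longlongrightarrow> 0) (at_right 0)" for \<omega>'
  proof
    assume "cohomogeneous \<omega>' f"
    then obtain c where c: "c > 0" and bound: "\<And>R x y. R > 0 \<Longrightarrow> x \<in> ball 0 R \<inter> int_lattice \<Longrightarrow>
        y \<in> ball 0 R \<inter> int_lattice \<Longrightarrow>
        norm (inv_into int_lattice f x - inv_into int_lattice f y) \<le> c * R * \<omega>' (norm (x - y) / R)"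
      unfolding cohomogeneous_def by blast
    \<comment> \<open>The factor 3 puts both \<open>4 ^ k\<close> and \<open>4 ^ k + 1\<close>
      inside the open ball.\<close>
    define R :: "nat \<Rightarrow> real" where "R k = 3 * 4 ^ k" for k
    \<comment> \<open>In the 6, a factor 3 comes from \<open>R k = 3 * 4 ^ k\<close> and a factor 2
      from rounding, since \<open>\<phi> (4 ^ k) < m k + 1 \<le> 2 * m k\<close>. As
      \<open>1 / R k\<close> tends to 0 from the right, this positive lower bound contradicts the
      limit.\<close>
    have "1 / (6 * c * \<omega> 1) \<le> \<omega>' (1 / R k) / \<omega> (1 / R k)" for k
    proof -
      define x y where "x = (axis a (of_int (4 ^ k)) :: real ^ 'n)"
        and "y = (axis a (of_int (4 ^ k + 1)) :: real ^ 'n)"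
      have ge1: "(1::real) \<le> 4 ^ k"
        by simp
      then have "3 \<le> R k"
        unfolding R_def by linarith
      then have R: "0 < R k" "1 / R k < 2"
        by (auto simp: pos_divide_less_eq)
      have lat: "x \<in> int_lattice" "y \<in> int_lattice"
        unfolding x_def y_def by (rule axis_in_lattice)+
      have "norm x < R k" "norm y < R k"
        using ge1 unfolding x_def y_def norm_axis R_def of_int_add of_int_power of_int_numeral of_int_1
        by linarith+
      with lat have "norm (on_coord a g x - on_coord a g y) \<le> c * R k * \<omega>' (norm (x - y) / R k)"
        using bound[OF R(1), of x y] by (simp add: inv)
      moreover have "x - y = axis a (- 1)"
        by (auto simp: x_def y_def axis_def vec_eq_iff)
      moreover have "on_coord a g x - on_coord a g y = axis a (of_int (1 - 2 * m k))"
        unfolding x_def y_def on_coord_axis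
        using blockwise_unzigzag_start[OF m_ge m_le, of k]
        by (auto simp: g_def axis_def vec_eq_iff)
      ultimately have "\<bar>of_int (1 - 2 * m k)\<bar> \<le> c * R k * \<omega>' (1 / R k)"
        by (simp add: norm_axis)
      moreover have "real_of_int (m k) \<le> \<bar>of_int (1 - 2 * m k)\<bar>"
        using m_ge[of k] by simp
      moreover have "\<phi> (4 ^ k) \<le> 2 * of_int (m k)"
        using m_ge[of k] unfolding m_def by linarith
      moreover have "R k * \<omega> (1 / R k) / (3 * \<omega> 1) \<le> \<phi> (4 ^ k)"
        using mono[of "1 / R k" "1 / 4 ^ k"] \<omega>1 ge1
        by (simp add: \<phi>_def R_def field_simps)
      ultimately have "R k * \<omega> (1 / R k) / (3 * \<omega> 1) \<le> 2 * (c * R k * \<omega>' (1 / R k))"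
        by linarith
      then show ?thesis
        using R \<omega>1 c pos[of "1 / R k"] by (simp add: field_simps)
    qed
    moreover have "(\<lambda>k. \<omega>' (1 / R k) / \<omega> (1 / R k)) \<longlonglongrightarrow> 0"
    proof (rule filterlim_compose[OF lim])
      have "(\<lambda>k. 1 / R k) \<longlonglongrightarrow> 0"
        using LIMSEQ_divide_realpow_zero[of 4 "1 / 3"] by (simp add: R_def)
      then show "filterlim (\<lambda>k. 1 / R k) (at_right 0) sequentially"
        by (auto simp: filterlim_at R_def)
    qed
    ultimately have "1 / (6 * c * \<omega> 1) \<le> 0"
      by (intro LIMSEQ_le_const) auto
    moreover have "0 < 1 / (6 * c * \<omega> 1)"
      using c \<omega>1 by simp
    ultimately show False
      by linarith
  qed
  moreover have "bij_betw f int_lattice int_lattice"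
    unfolding f_def using bij_betw_on_coord[OF gh hg] .
  moreover have "3-lipschitz_on int_lattice f"
    unfolding f_def h_def
    using lipschitz_on_coord[of 3, OF _ blockwise_zigzag_Lipschitz[OF m_ge m_le]] by simp
  ultimately show ?thesis
    by (intro exI[of _ f] conjI) auto
qed

end
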